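(* Let $d\ge 2$, $n\ge d$ and $k\ge 1$ be integers, and put $c=\left\lceil n/\sum_{j=0}^k d^j\right\rceil$. If $(d^{k-1}+d^k)\,c\ge n$ or $d^{k-1}c\ge \lceil n/(d+1)\rceil$, then $\gamma_k(G_K(n,d)) = c$.
   Context: The generalized Kautz digraph $G_K(n,d)$ has vertex set $\{0,1,\dots,n-1\}$ and an arc $(x,y)$ whenever $y\equiv -dx-i \pmod n$ for some $1\le i\le d$ (self-loops allowed, no multiple arcs). A set $D$ of vertices of a digraph $G$ is a distance $k$-dominating set if every vertex $v\notin D$ has some $u\in D$ with a directed path from $u$ to $v$ of length at most $k$. $\gamma_k(G)$ denotes the minimum cardinality of a distance $k$-dominating set of $G$. *)

theory Defs
  imports Complex_Main "Graph_Theory.Graph_Theory" "HOL-Number_Theory.Cong"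
begin

definition gen_kautz :: "nat \<Rightarrow> nat \<Rightarrow> int pair_pre_digraph" where
  "gen_kautz n d =
    \<lparr> pverts = {0..<int n},
      parcs = {(x, y). x \<in> {0..<int n} \<and> y \<in> {0..<int n} \<and>
                 (\<exists>i\<in>{1..int d}. [y = - int d * x - i] (mod int n))} \<rparr>"

definition dist_dominating :: "('a, 'b) pre_digraph \<Rightarrow> nat \<Rightarrow> 'a set \<Rightarrow> bool" where
  "dist_dominating G k D \<longleftrightarrow>
    D \<subseteq> verts G \<and>
    (\<forall>v \<in> verts G - D. \<exists>u \<in> D. \<exists>p. pre_digraph.apath G u p v \<and> length p \<le> k)"

text \<open>Meaningful for finite digraphs, where the whole vertex set is a dominating set
  of finite cardinality.\<close>

definition dist_domination_number :: "nat \<Rightarrow> ('a, 'b) pre_digraph \<Rightarrow> nat" where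
  "dist_domination_number k G = (LEAST m. \<exists>D. finite D \<and> dist_dominating G k D \<and> card D = m)"

end

theory Submission
  imports Defs
begin

text \<open>
  Every vertex reaches at most \<open>d ^ j\<close> vertices by walks of length \<open>j\<close>, so a dominating set has at
  least \<open>n / (\<Sum>j\<le>k. d ^ j)\<close> elements. Conversely take \<open>D = {0..<c}\<close>: modulo \<open>n\<close>, an
  interval \<open>[0, L)\<close> has the out-neighbourhood \<open>[-dL, 0)\<close>, and \<open>[-L, 0)\<close> has \<open>[0, dL)\<close>. Hence the
  vertices at the ends of walks of length \<open>k - 1\<close> and \<open>k\<close> from \<open>D\<close> form two intervals of lengths
  \<open>d ^ (k - 1) * c\<close> and \<open>d ^ k * c\<close> adjacent at \<open>0\<close> on opposite sides, which together cover
  all residues as soon as their lengths sum to \<open>n\<close>. The second alternative of the hypothesis implies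
  the first.
\<close>

text \<open>Splitting off the last step, each endpoint of a walk of length \<open>j\<close> has at
  most \<open>d\<close> successors. Finiteness is carried through the induction because the bound on
  a union needs a finite index set.\<close>

lemma card_relpow_Image_le:
  fixes R :: "'a rel"
  assumes "\<And>x. finite (R `` {x}) \<and> card (R `` {x}) \<le> d"
  shows "finite ((R ^^ j) `` {u}) \<and> card ((R ^^ j) `` {u}) \<le> d ^ j"
proof (induction j)
  case 0
  show ?case by simp
next
  case (Suc j)
  have eq: "(R ^^ Suc j) `` {u} = (\<Union>x \<in> (R ^^ j) `` {u}. R `` {x})"
    by auto
  have "card (\<Union>x \<in> (R ^^ j) `` {u}. R `` {x}) \<le> (\<Sum>x \<in> (R ^^ j) `` {u}. card (R `` {x}))"
    using Suc.IH by (intro card_UN_le) auto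
  also have "\<dots> \<le> card ((R ^^ j) `` {u}) * d"
    using sum_bounded_above[of "(R ^^ j) `` {u}" "\<lambda>x. card (R `` {x})" d] assms by simp
  also have "\<dots> \<le> d ^ j * d"
    using Suc.IH by (intro mult_right_mono) auto
  finally show ?case
    using Suc.IH assms unfolding eq by (simp add: mult.commute)
qed

context wf_digraph
begin

lemma awalk_imp_relpow: "awalk u p v \<Longrightarrow> (u, v) \<in> arcs_ends G ^^ length p"
proof (induction p arbitrary: u)
  case Nil
  then show ?case by (simp add: awalk_Nil_iff)
next
  case (Cons e p)
  then have "(u, head G e) \<in> arcs_ends G" "(head G e, v) \<in> arcs_ends G ^^ length p"
    by (auto simp: awalk_Cons_iff arcs_ends_conv)
  \<comment> \<open>\<open>awalk\<close> peels arcs off the front, whereas \<open>^^\<close> appends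
    the new factor at the back.\<close>
  then show ?case by (simp add: relpow_commute[symmetric] relcomp.relcompI)
qed

text \<open>The start must be a vertex because the zeroth power is the identity on the whole
  type.\<close>

lemma relpow_imp_awalk:
  "(u, v) \<in> arcs_ends G ^^ j \<Longrightarrow> u \<in> verts G \<Longrightarrow> \<exists>p. awalk u p v \<and> length p = j"
proof (induction j arbitrary: v)
  case 0
  then show ?case by (auto simp: awalk_Nil_iff)
next
  case (Suc j)
  then obtain w e where "(u, w) \<in> arcs_ends G ^^ j" "e \<in> arcs G" "tail G e = w" "head G e = v"
    by (auto simp: arcs_ends_conv)
  with Suc obtain p where "awalk u p w" "length p = j" by blast
  moreover have "awalk w [e] v"
    using \<open>e \<in> arcs G\<close> \<open>tail G e = w\<close> \<open>head G e = v\<close> arc_implies_awalk by blast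
  ultimately have "awalk u (p @ [e]) v \<and> length (p @ [e]) = Suc j"
    using awalk_appendI by simp
  then show ?case by blast
qed

text \<open>A repeated vertex yields a nonempty closed subwalk; cutting it out shortens the
  walk.\<close>

lemma awalk_imp_apath_le: "awalk u p v \<Longrightarrow> \<exists>q. apath u q v \<and> length q \<le> length p"
proof (induction p rule: length_induct)
  case (1 p)
  show ?case
  proof (cases "distinct (awalk_verts u p)")
    case True
    with 1 show ?thesis by (auto simp: apath_def)
  next
    case False
    obtain q r s w where "p = q @ r @ s" "0 < length r" "awalk u q w" "awalk w s v"
      using awalk_not_distinct_decomp[OF \<open>awalk u p v\<close> False] by blast
    then have "awalk u (q @ s) v" "length (q @ s) < length p"
      using awalk_appendI by auto
    with 1 show ?thesis by (meson le_trans less_imp_le)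
  qed
qed

text \<open>Trades simple paths for powers of the arc relation, on which both the counting bound and
  the interval construction operate. The power \<open>j = 0\<close> accounts for the members of
  \<open>D\<close> themselves.\<close>

lemma dist_dominating_iff_relpow:
  "dist_dominating G k D \<longleftrightarrow>
    D \<subseteq> verts G \<and> verts G \<subseteq> (\<Union>u\<in>D. \<Union>j\<le>k. (arcs_ends G ^^ j) `` {u})"
proof (intro iffI conjI)
  assume dom: "dist_dominating G k D"
  then show "D \<subseteq> verts G" by (simp add: dist_dominating_def)
  show "verts G \<subseteq> (\<Union>u\<in>D. \<Union>j\<le>k. (arcs_ends G ^^ j) `` {u})"
  proof
    fix v assume v: "v \<in> verts G"
    show "v \<in> (\<Union>u\<in>D. \<Union>j\<le>k. (arcs_ends G ^^ j) `` {u})"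
    proof (cases "v \<in> D")
      case True
      have "(v, v) \<in> arcs_ends G ^^ 0" by simp
      with True show ?thesis by blast
    next
      case False
      with dom v obtain u p where "u \<in> D" "apath u p v" "length p \<le> k"
        unfolding dist_dominating_def by blast
      then show ?thesis
        using awalk_imp_relpow[OF awalkI_apath] by blast
    qed
  qed
next
  assume *: "D \<subseteq> verts G \<and> verts G \<subseteq> (\<Union>u\<in>D. \<Union>j\<le>k. (arcs_ends G ^^ j) `` {u})"
  show "dist_dominating G k D"
    unfolding dist_dominating_def
  proof (intro conjI ballI)
    show "D \<subseteq> verts G" using * by blast
    fix v assume "v \<in> verts G - D"
    with * obtain u j where uj: "u \<in> D" "j \<le> k" "(u, v) \<in> arcs_ends G ^^ j" by blast
    with * obtain p where "awalk u p v" "length p = j" using relpow_imp_awalk by blast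
    then obtain q where "apath u q v" "length q \<le> j" using awalk_imp_apath_le by blast
    then show "\<exists>u\<in>D. \<exists>p. apath u p v \<and> length p \<le> k"
      using uj by (meson le_trans)
  qed
qed

lemma card_verts_le_dist_dominating:
  assumes out: "\<And>x. finite (arcs_ends G `` {x}) \<and> card (arcs_ends G `` {x}) \<le> d"
    and "finite D" and dom: "dist_dominating G k D"
  shows "card (verts G) \<le> card D * (\<Sum>j\<le>k. d ^ j)"
proof -
  let ?N = "\<lambda>u j. (arcs_ends G ^^ j) `` {u}"
  have N: "finite (?N u j)" "card (?N u j) \<le> d ^ j" for u j
    using card_relpow_Image_le[OF out] by blast+
  have "card (verts G) \<le> card (\<Union>u\<in>D. \<Union>j\<le>k. ?N u j)"
    using dom \<open>finite D\<close> N(1) unfolding dist_dominating_iff_relpow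
    by (intro card_mono) auto
  also have "\<dots> \<le> (\<Sum>u\<in>D. card (\<Union>j\<le>k. ?N u j))"
    using \<open>finite D\<close> by (rule card_UN_le)
  also have "\<dots> \<le> (\<Sum>u\<in>D. \<Sum>j\<le>k. card (?N u j))"
    by (intro sum_mono card_UN_le) simp
  also have "\<dots> \<le> (\<Sum>u\<in>D. \<Sum>j\<le>k. d ^ j)"
    by (intro sum_mono N(2))
  finally show ?thesis by simp
qed

end

lemma wf_digraph_gen_kautz: "wf_digraph (with_proj (gen_kautz n d))"
  by unfold_locales (auto simp: gen_kautz_def)

lemma gen_kautz_out_degree:
  "finite (parcs (gen_kautz n d) `` {x}) \<and> card (parcs (gen_kautz n d) `` {x}) \<le> d"
proof -
  let ?f = "\<lambda>i. (- int d * x - i) mod int n"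
  have sub: "parcs (gen_kautz n d) `` {x} \<subseteq> ?f ` {1..int d}"
    by (auto simp: gen_kautz_def cong_def)
  have "card (?f ` {1..int d}) \<le> d"
    using card_image_le[of "{1..int d}" ?f] by simp
  then show ?thesis
    using sub finite_subset[OF sub] card_mono[OF _ sub] by (auto intro: order.trans)
qed

text \<open>Lets arcs be computed with arbitrary integer representatives, negative ones
  included.\<close>

lemma gen_kautz_arcI:
  assumes "0 < n" "1 \<le> i" "i \<le> int d" "y = - int d * x - i"
  shows "(x mod int n, y mod int n) \<in> parcs (gen_kautz n d)"
proof -
  have "[y mod int n = - int d * (x mod int n) - i] (mod int n)"
    unfolding assms(4) cong_mod_left by (intro cong_diff cong_mult) (simp_all add: cong_def)
  with assms show ?thesis by (auto simp: gen_kautz_def)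
qed

text \<open>The index \<open>t\<close> counts upwards from 0 for even \<open>j\<close> and downwards
  from -1 for odd \<open>j\<close>. Writing \<open>t = d * s + r\<close> with \<open>r < d\<close>,
  the point of index \<open>t\<close> is entered from the point of index \<open>s\<close> one step
  earlier, and \<open>r\<close> selects the arc.\<close>

lemma gen_kautz_reach_interval:
  assumes "0 < n" "c \<le> n" "t < d ^ j * c"
  shows "\<exists>u\<in>{0..<int c}.
    (u, (if even j then int t else - 1 - int t) mod int n) \<in> parcs (gen_kautz n d) ^^ j"
  using assms(3)
proof (induction j arbitrary: t)
  case 0
  with assms show ?case by auto
next
  case (Suc j)
  define s r where "s = t div d" and "r = t mod d"
  have "0 < d" using Suc.prems by (cases d) auto
  then have r: "r < d" and t: "int t = int d * int s + int r"
    by (simp_all add: r_def s_def flip: of_nat_mult of_nat_add)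
  have "s < d ^ j * c"
    using Suc.prems \<open>0 < d\<close> by (simp add: s_def div_less_iff_less_mult mult_ac)
  then obtain u where u: "u \<in> {0..<int c}"
    "(u, (if even j then int s else - 1 - int s) mod int n) \<in> parcs (gen_kautz n d) ^^ j"
    using Suc.IH by blast
  \<comment> \<open>Solves \<open>y = - d * x - i\<close> for \<open>i\<close>: with
    \<open>x = s\<close>, \<open>y = - 1 - t\<close> for even \<open>j\<close>, and with
    \<open>x = - 1 - s\<close>, \<open>y = t\<close> for odd \<open>j\<close>. Both values lie in
    \<open>{1..d}\<close> since \<open>r < d\<close>.\<close>
  let ?i = "if even j then int r + 1 else int d - int r"
  have "((if even j then int s else - 1 - int s) mod int n,
      (if even (Suc j) then int t else - 1 - int t) mod int n) \<in> parcs (gen_kautz n d)"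
    by (rule gen_kautz_arcI[where i = ?i]) (use r assms in \<open>auto simp: t algebra_simps\<close>)
  with u show ?case by (auto intro!: bexI[of _ u])
qed

lemma gen_kautz_initial_segment_dominating:
  assumes "0 < n" "c \<le> n" "1 \<le> k" "n \<le> (d ^ (k - 1) + d ^ k) * c"
  shows "dist_dominating (with_proj (gen_kautz n d)) k {0..<int c}"
proof -
  interpret wf_digraph "with_proj (gen_kautz n d)" by (rule wf_digraph_gen_kautz)
  \<comment> \<open>Of the exponents \<open>k - 1\<close> and \<open>k\<close>, the even one
    \<open>a\<close> covers vertices from 0 upwards, the odd one \<open>b\<close> those from
    \<open>n - 1\<close> downwards.\<close>
  define a b where "a = (if even k then k else k - 1)" and "b = (if even k then k - 1 else k)"
  have ab: "even a" "odd b" "a \<le> k" "b \<le> k" and len: "n \<le> d ^ a * c + d ^ b * c"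
    using assms(3,4) by (auto simp: a_def b_def algebra_simps)
  have "\<exists>u\<in>{0..<int c}. \<exists>j\<le>k. (u, v) \<in> parcs (gen_kautz n d) ^^ j"
    if v: "0 \<le> v" "v < int n" for v
  proof (cases "nat v < d ^ a * c")
    case True
    from gen_kautz_reach_interval[OF assms(1,2) this] ab v show ?thesis by auto
  next
    case False
    define t where "t = n - 1 - nat v"
    have "t < d ^ b * c" using False len v by (auto simp: t_def)
    moreover have "(- 1 - int t) mod int n = v"
    proof -
      have "- 1 - int t = v + int n * (- 1)" using v by (simp add: t_def of_nat_diff)
      then show ?thesis using v by (simp only: mod_mult_self2) simp
    qed
    ultimately show ?thesis
      using gen_kautz_reach_interval[OF assms(1,2), of t d b] ab by auto
  qed
  then show ?thesis
    using assms(2) unfolding dist_dominating_iff_relpow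
    by (fastforce simp: gen_kautz_def)
qed

theorem theorem3p2:
  fixes d n k c :: nat
  assumes "d \<ge> 2" and "n \<ge> d" and "k \<ge> 1"
    and "c = nat \<lceil>real n / (\<Sum>j=0..k. real d ^ j)\<rceil>"
    and "(d ^ (k - 1) + d ^ k) * c \<ge> n \<or>
         int (d ^ (k - 1) * c) \<ge> \<lceil>real n / (real d + 1)\<rceil>"
  shows "dist_domination_number k (with_proj (gen_kautz n d)) = c"
proof -
  interpret wf_digraph "with_proj (gen_kautz n d)" by (rule wf_digraph_gen_kautz)
  define S where "S = (\<Sum>j\<le>k. d ^ j)"
  have "1 \<le> S"
    unfolding S_def using member_le_sum[of 0 "{..k}" "\<lambda>j. d ^ j"] by simp
  \<comment> \<open>Removes the real ceiling once and for all: \<open>m = n\<close> gives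
    \<open>c \<le> n\<close>, and the size of a dominating set as \<open>m\<close> gives the lower
    bound.\<close>
  have c_le_iff: "c \<le> m \<longleftrightarrow> n \<le> m * S" for m
  proof -
    have "(\<Sum>j=0..k. real d ^ j) = real S" by (simp add: S_def atLeast0AtMost)
    then have "c \<le> m \<longleftrightarrow> real n / real S \<le> real m"
      unfolding assms(4) by (simp add: ceiling_le_iff)
    also have "\<dots> \<longleftrightarrow> real n \<le> real (m * S)"
      using \<open>1 \<le> S\<close> by (simp add: pos_divide_le_eq)
    finally show ?thesis by (simp only: of_nat_le_iff)
  qed
  have len: "n \<le> (d ^ (k - 1) + d ^ k) * c"
    using assms(5)
  proof
    assume "int (d ^ (k - 1) * c) \<ge> \<lceil>real n / (real d + 1)\<rceil>"
    then have "real n / (real d + 1) \<le> real (d ^ (k - 1) * c)"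
      by (simp add: ceiling_le_iff)
    then have "real n \<le> real (d ^ (k - 1) * c * (d + 1))"
      by (simp add: pos_divide_le_eq algebra_simps)
    then have "n \<le> d ^ (k - 1) * c * (d + 1)" by (simp only: of_nat_le_iff)
    \<comment> \<open>Hence \<open>d ^ (k - 1) + d ^ k = d ^ (k - 1) * (d + 1)\<close>, so the
      second alternative multiplied by \<open>d + 1\<close> is the first.\<close>
    moreover have "d ^ k = d * d ^ (k - 1)" using assms(3) by (cases k) auto
    ultimately show ?thesis by (simp add: algebra_simps)
  qed
  have "c \<le> n" using c_le_iff \<open>1 \<le> S\<close> by simp
  then have dom: "dist_dominating (with_proj (gen_kautz n d)) k {0..<int c}"
    using assms len by (intro gen_kautz_initial_segment_dominating) auto
  show ?thesis
    unfolding dist_domination_number_def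
  proof (rule Least_equality)
    show "\<exists>D. finite D \<and> dist_dominating (with_proj (gen_kautz n d)) k D \<and> card D = c"
      using dom by (intro exI[of _ "{0..<int c}"]) simp
  next
    fix m assume "\<exists>D. finite D \<and> dist_dominating (with_proj (gen_kautz n d)) k D \<and> card D = m"
    then obtain D where D: "finite D" "dist_dominating (with_proj (gen_kautz n d)) k D" "card D = m"
      by blast
    have "card (pverts (gen_kautz n d)) \<le> card D * S"
      using card_verts_le_dist_dominating[of d D k] gen_kautz_out_degree D by (simp add: S_def)
    then show "c \<le> m"
      unfolding c_le_iff using D by (simp add: gen_kautz_def)
  qed
qed

end
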